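(* Let $A$ be a (nonzero) Euclidean metrised algebra. Then for any extremal idempotent $c\in A$, $$\sigma(c)\setminus\{1\}\subset \left(-\infty,\tfrac12\right],$$ and $1$ is a simple eigenvalue of $L_c$.
   Context: A Euclidean metrised algebra is a finite-dimensional commutative, not necessarily associative, algebra $A$ over $\mathbb{R}$ with a positive definite symmetric bilinear form $\langle \cdot;\cdot\rangle$ satisfying $\langle xy;z\rangle=\langle x;yz\rangle$ for all $x,y,z\in A$; "nonzero" means that the multiplication is not identically zero. For $x\in A$, $L_x y=xy$ (a self-adjoint operator). An idempotent is an element $c$ with $c^2=c$; $\sigma(c)$ is the spectrum of $L_c$ (for $c\neq 0$ it contains $1$, since $L_cc=c$). Extremal idempotents: let $y$ be a point of the unit sphere $\{x\in A:\langle x;x\rangle=1\}$ at which the cubic form $u(x)=\frac16\langle x^2;x\rangle$ attains its global maximum on that sphere; then $y^2=ky$ for some real $k>0$, and $c=y/k$ is a nonzero idempotent. Idempotents obtained in this way are called extremal; equivalently, they are the nonzero idempotents that are global maximum points of $x\mapsto\langle x;x^2\rangle\langle x;x\rangle^{-3/2}$ on $A\setminus\{0\}$. *)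

theory Defs
  imports "HOL-Analysis.Analysis"
begin

text \<open>The underlying space and the form are those of the class \<open>euclidean_space\<close>: a
  finite-dimensional real vector space with a positive definite symmetric bilinear form
  \<open>x \<bullet> y\<close>. No associativity or unit is required of the multiplication.\<close>

locale euclidean_metrised_algebra =
  fixes mul :: "'a::euclidean_space \<Rightarrow> 'a \<Rightarrow> 'a"
  assumes bilinear_mult: "bilinear mul"
    and mult_commute: "mul x y = mul y x"
    and form_assoc: "mul x y \<bullet> z = x \<bullet> mul y z"

definition nonzero_algebra :: "('a::euclidean_space \<Rightarrow> 'a \<Rightarrow> 'a) \<Rightarrow> bool"
  where "nonzero_algebra mul \<longleftrightarrow> (\<exists>x y. mul x y \<noteq> 0)"

definition cubic_form :: "('a::euclidean_space \<Rightarrow> 'a \<Rightarrow> 'a) \<Rightarrow> 'a \<Rightarrow> real"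
  where "cubic_form mul x = (mul x x \<bullet> x) / 6"

definition extremal_idempotent :: "('a::euclidean_space \<Rightarrow> 'a \<Rightarrow> 'a) \<Rightarrow> 'a \<Rightarrow> bool"
  where "extremal_idempotent mul c \<longleftrightarrow>
    (\<exists>y k. y \<bullet> y = 1 \<and> (\<forall>x. x \<bullet> x = 1 \<longrightarrow> cubic_form mul x \<le> cubic_form mul y)
         \<and> k > 0 \<and> mul y y = k *\<^sub>R y \<and> c = y /\<^sub>R k)"

definition eigenvalue :: "('a::real_vector \<Rightarrow> 'a) \<Rightarrow> real \<Rightarrow> bool"
  where "eigenvalue f l \<longleftrightarrow> (\<exists>x. x \<noteq> 0 \<and> f x = l *\<^sub>R x)"

text \<open>The generalised eigenspace; its dimension is the algebraic multiplicity of \<open>l\<close>.\<close>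

definition generalised_eigenspace :: "('a::real_vector \<Rightarrow> 'a) \<Rightarrow> real \<Rightarrow> 'a set"
  where "generalised_eigenspace f l = {x. \<exists>n. ((\<lambda>z. f z - l *\<^sub>R z) ^^ n) x = 0}"

definition simple_eigenvalue :: "('a::euclidean_space \<Rightarrow> 'a) \<Rightarrow> real \<Rightarrow> bool"
  where "simple_eigenvalue f l \<longleftrightarrow> eigenvalue f l \<and> dim (generalised_eigenspace f l) = 1"

text \<open>Real eigenvalues make up the whole spectrum, because \<open>L\<^sub>c = mul c\<close> is self-adjoint.\<close>

definition spectrum :: "('a::euclidean_space \<Rightarrow> 'a \<Rightarrow> 'a) \<Rightarrow> 'a \<Rightarrow> real set"
  where "spectrum mul c = {l. eigenvalue (mul c) l}"

end

theory Submission
  imports Defs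
begin

text \<open>If \<open>y\<close> is a maximum point of the cubic form on the unit sphere, then
  \<open>x\<^sup>2 \<bullet> x \<le> k |x|\<^sup>3\<close> for all \<open>x\<close>, with equality at \<open>y\<close>. The second order expansion of this
  inequality at \<open>y\<close> in a direction \<open>z\<close> orthogonal to \<open>y\<close> bounds the quadratic form of \<open>L\<^sub>c\<close>
  on the orthogonal complement of \<open>c\<close> by \<open>1/2\<close>. Since \<open>L\<^sub>c\<close> is self-adjoint, the eigenvectors
  for eigenvalues other than \<open>1\<close> lie in that complement, and the eigenvalue \<open>1\<close> does not occur
  on it.\<close>

text \<open>The right-hand side is 1 + (3/2) t^2 + O(t^4), so this compares second order
  coefficients, at one explicit \<open>t\<close> in place of a limit.\<close>

lemma coeff_le_half:
  fixes a :: real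
  assumes "\<And>t. 1 + 3 * a * t\<^sup>2 \<le> sqrt (1 + t\<^sup>2) ^ 3"
  shows "a \<le> 1/2"
proof (rule ccontr)
  assume "\<not> a \<le> 1/2"
  then have a: "a > 1/2" by simp
  \<comment> \<open>With t^2 = \<open>s\<close>, squaring and dividing by \<open>s\<close> leaves
    \<open>main\<close>. The bound \<open>s\<close> \<le> 2a - 1 gives 6a \<ge> 3 + 3s, and
    \<open>s\<close> \<le> 1 gives s^2 \<le> s < 9s/4 \<le> 9 a^2 s, which contradicts
    \<open>main\<close>.\<close>
  define s where "s = min 1 (2 * a - 1)"
  have s: "0 < s" "s \<le> 1" "s \<le> 2 * a - 1"
    using a by (auto simp: s_def)
  have "1 + 3 * a * s \<le> sqrt (1 + s) ^ 3"
    using assms[of "sqrt s"] s by simp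
  then have "(1 + 3 * a * s)\<^sup>2 \<le> (sqrt (1 + s) ^ 3)\<^sup>2"
    by (rule power_mono) (use a s in simp)
  also have "\<dots> = ((sqrt (1 + s))\<^sup>2) ^ 3"
    by (simp only: power_mult[symmetric] mult.commute)
  also have "\<dots> = (1 + s) ^ 3"
    using s by simp
  finally have "s * (6 * a + 9 * a\<^sup>2 * s) \<le> s * (3 + 3 * s + s\<^sup>2)"
    by (simp add: power2_eq_square power3_eq_cube algebra_simps)
  then have main: "6 * a + 9 * a\<^sup>2 * s \<le> 3 + 3 * s + s\<^sup>2"
    using s by simp
  have "(1/2)\<^sup>2 \<le> a\<^sup>2"
    using a by (intro power_mono) auto
  then have "1/4 * s \<le> a\<^sup>2 * s"
    using s by (intro mult_right_mono) (auto simp: power2_eq_square)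
  moreover have "s\<^sup>2 \<le> s"
    using s by (simp add: power2_eq_square mult_left_le_one_le)
  ultimately show False
    using main s by linarith
qed

text \<open>Self-adjointness turns |T v|^2 into the product of v with T (T v), so T (T v) = 0 forces
  T v = 0, and the exponent descends one step at a time.\<close>

lemma funpow_eq_0_self_adjoint:
  fixes T :: "'a::real_inner \<Rightarrow> 'a"
  assumes adj: "\<And>x y. T x \<bullet> y = x \<bullet> T y"
    and "(T ^^ Suc n) x = 0"
  shows "T x = 0"
  using assms(2)
proof (induction n)
  case (Suc n)
  let ?v = "(T ^^ n) x"
  have "T ?v \<bullet> T ?v = ?v \<bullet> T (T ?v)"
    by (rule adj)
  then have "T ?v = 0"
    using Suc.prems by simp
  then show ?case
    using Suc.IH by simp
qed simp

text \<open>Makes algebraic and geometric multiplicity agree. Exponent 0 only admits x = 0, which is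
  where \<open>f 0 = 0\<close> enters.\<close>

lemma generalised_eigenspace_self_adjoint:
  fixes f :: "'a::real_inner \<Rightarrow> 'a"
  assumes "\<And>x y. f x \<bullet> y = x \<bullet> f y" and "f 0 = 0"
  shows "generalised_eigenspace f l = {x. f x = l *\<^sub>R x}"
proof -
  let ?T = "\<lambda>z. f z - l *\<^sub>R z"
  have "?T x = 0" if "(?T ^^ n) x = 0" for n x
  proof (cases n)
    case 0
    then show ?thesis using that assms(2) by simp
  next
    case (Suc m)
    then show ?thesis
      using funpow_eq_0_self_adjoint[of ?T m x] assms(1) that
      by (simp add: inner_diff_left inner_diff_right)
  qed
  moreover have "(?T ^^ 1) x = 0" if "f x = l *\<^sub>R x" for x
    using that by simp
  ultimately show ?thesis
    unfolding generalised_eigenspace_def by (fastforce intro: exI[of _ 1])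
qed

context euclidean_metrised_algebra
begin

lemmas mul_simps =
  bilinear_ladd[OF bilinear_mult] bilinear_radd[OF bilinear_mult]
  bilinear_lmul[OF bilinear_mult] bilinear_rmul[OF bilinear_mult]
  bilinear_rsub[OF bilinear_mult] bilinear_rzero[OF bilinear_mult]

lemma mul_self_adjoint: "mul c x \<bullet> y = x \<bullet> mul c y"
  by (metis form_assoc mult_commute)

text \<open>Both sides are homogeneous of degree 3 under positive scaling, so the bound on the unit
  sphere suffices.\<close>

lemma cubic_le_norm_cube:
  assumes max: "\<And>x. x \<bullet> x = 1 \<Longrightarrow> mul x x \<bullet> x \<le> k"
  shows "mul x x \<bullet> x \<le> k * norm x ^ 3"
proof (cases "x = 0")
  case False
  define u where "u = x /\<^sub>R norm x"
  have x: "x = norm x *\<^sub>R u"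
    using False by (simp add: u_def)
  have "u \<bullet> u = 1"
    using False by (simp add: u_def power2_norm_eq_inner[symmetric] power2_eq_square)
  then have "norm x ^ 3 * (mul u u \<bullet> u) \<le> norm x ^ 3 * k"
    by (intro mult_left_mono max) auto
  moreover have "mul x x \<bullet> x = norm x ^ 3 * (mul u u \<bullet> u)"
    by (subst (1 2 3) x) (simp only: mul_simps, simp add: power3_eq_cube)
  ultimately show ?thesis
    by (simp add: mult.commute)
qed simp

text \<open>The trilinear form \<open>mul x y \<bullet> z\<close> is totally symmetric, hence the
  binomial coefficients.\<close>

lemma cubic_add_scaleR:
  "mul (y + t *\<^sub>R z) (y + t *\<^sub>R z) \<bullet> (y + t *\<^sub>R z)
    = mul y y \<bullet> y + 3 * t * (mul y y \<bullet> z) + 3 * t\<^sup>2 * (mul y z \<bullet> z) + t ^ 3 * (mul z z \<bullet> z)"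
proof -
  have "mul z z \<bullet> y = mul y z \<bullet> z" "mul y z \<bullet> y = mul y y \<bullet> z" "mul z y = mul y z"
    by (metis form_assoc mult_commute inner_commute)+
  then show ?thesis
    by (simp add: mul_simps inner_add_left inner_add_right power2_eq_square power3_eq_cube
        algebra_simps)
qed

lemma extremal_quadratic_le_half:
  assumes "extremal_idempotent mul c" and orth: "z \<bullet> c = 0"
  shows "mul c z \<bullet> z \<le> 1/2 * (z \<bullet> z)"
proof (cases "z = 0")
  case False
  obtain y k where y: "y \<bullet> y = 1" "mul y y = k *\<^sub>R y" and k: "k > 0" and c: "c = y /\<^sub>R k"
    and max: "\<And>x. x \<bullet> x = 1 \<Longrightarrow> cubic_form mul x \<le> cubic_form mul y"
    using assms(1) unfolding extremal_idempotent_def by blast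
  have yz: "y \<bullet> z = 0"
    using orth k by (simp add: c inner_commute)
  define u where "u = z /\<^sub>R norm z"
  have z: "z = norm z *\<^sub>R u"
    using False by (simp add: u_def)
  have u: "u \<bullet> u = 1" "y \<bullet> u = 0"
    using False yz by (simp_all add: u_def power2_norm_eq_inner[symmetric] power2_eq_square)
  define a where "a = mul c u \<bullet> u"
  have yu: "mul y u \<bullet> u = k * a"
    using k by (simp add: a_def c mul_simps)
  \<comment> \<open>Since \<open>y\<close> is a unit vector with
    \<open>mul y y = k *\<^sub>R y\<close>, the maximum of \<open>mul x x \<bullet> x\<close> on the
    sphere is exactly \<open>k\<close>.\<close>
  have bound: "mul x x \<bullet> x \<le> k * norm x ^ 3" for x
    using max y by (intro cubic_le_norm_cube) (simp add: cubic_form_def)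
  \<comment> \<open>The linear term has vanished: \<open>mul y y\<close> is a multiple of
    \<open>y\<close>, which is orthogonal to \<open>u\<close>.\<close>
  have *: "k + 3 * t\<^sup>2 * (k * a) + t ^ 3 * (mul u u \<bullet> u) \<le> k * sqrt (1 + t\<^sup>2) ^ 3" for t
  proof -
    have "norm (y + t *\<^sub>R u) = sqrt (1 + t\<^sup>2)"
      using u y by (simp add: norm_eq_sqrt_inner inner_add_left inner_add_right inner_commute
          power2_eq_square)
    then show ?thesis
      using bound[of "y + t *\<^sub>R u"] u y yu unfolding cubic_add_scaleR by simp
  qed
  have "1 + 3 * a * t\<^sup>2 \<le> sqrt (1 + t\<^sup>2) ^ 3" for t
  proof -
    \<comment> \<open>averaging over \<open>t\<close> and \<open>-t\<close> removes the cubic term\<close>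
    have "k + 3 * t\<^sup>2 * (k * a) \<le> k * sqrt (1 + t\<^sup>2) ^ 3"
      using *[of t] *[of "-t"] by simp
    then have "k * (1 + 3 * a * t\<^sup>2) \<le> k * sqrt (1 + t\<^sup>2) ^ 3"
      by (simp add: algebra_simps)
    then show ?thesis
      using k by simp
  qed
  then have "a \<le> 1/2"
    by (rule coeff_le_half)
  then have "(norm z)\<^sup>2 * a \<le> (norm z)\<^sup>2 * (1/2)"
    by (intro mult_left_mono) auto
  moreover have "mul c z \<bullet> z = (norm z)\<^sup>2 * a"
    by (subst (1 2) z) (simp only: mul_simps, simp add: a_def power2_eq_square)
  ultimately show ?thesis
    by (simp add: power2_norm_eq_inner)
qed (simp add: mul_simps)

lemma extremal_idempotentD:
  assumes "extremal_idempotent mul c"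
  shows "c \<noteq> 0" and "mul c c = c"
  using assms unfolding extremal_idempotent_def by (auto simp: mul_simps)

lemma extremal_spectrum:
  assumes c: "extremal_idempotent mul c" and "l \<in> spectrum mul c" and "l \<noteq> 1"
  shows "l \<le> 1/2"
proof -
  obtain z where z: "z \<noteq> 0" "mul c z = l *\<^sub>R z"
    using assms(2) unfolding spectrum_def eigenvalue_def by blast
  have "l * (z \<bullet> c) = z \<bullet> c"
    using mul_self_adjoint[of c z c] extremal_idempotentD(2)[OF c] z by simp
  then have "z \<bullet> c = 0"
    using assms(3) by simp
  then have "l * (z \<bullet> z) \<le> 1/2 * (z \<bullet> z)"
    using extremal_quadratic_le_half[OF c, of z] z by simp
  then show ?thesis
    using z(1) by simp
qed

lemma extremal_eigenspace_one:
  assumes c: "extremal_idempotent mul c"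
  shows "{x. mul c x = x} = span {c}"
proof (intro set_eqI iffI)
  fix x
  note nz = extremal_idempotentD[OF c]
  assume "x \<in> {x. mul c x = x}"
  then have x: "mul c x = x" by simp
  \<comment> \<open>Removing the orthogonal projection onto \<open>c\<close> leaves a vector
    \<open>w\<close> that \<open>mul c\<close> still fixes, so |w|^2 is at most half of
    itself.\<close>
  define r w where "r = (x \<bullet> c) / (c \<bullet> c)" and "w = x - r *\<^sub>R c"
  have "w \<bullet> c = 0"
    using nz by (simp add: w_def r_def inner_diff_left)
  moreover have "mul c w = w"
    using x nz by (simp add: w_def mul_simps)
  ultimately have "w \<bullet> w \<le> 1/2 * (w \<bullet> w)"
    using extremal_quadratic_le_half[OF c, of w] by simp
  then have "w = 0"
    using inner_gt_zero_iff[of w] by fastforce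
  then have "x = r *\<^sub>R c"
    by (simp add: w_def)
  then show "x \<in> span {c}"
    by (auto simp: span_singleton)
next
  fix x
  assume "x \<in> span {c}"
  then show "x \<in> {x. mul c x = x}"
    using extremal_idempotentD(2)[OF c] by (auto simp: span_singleton mul_simps)
qed

lemma extremal_simple_eigenvalue:
  assumes c: "extremal_idempotent mul c"
  shows "simple_eigenvalue (mul c) 1"
proof -
  note nz = extremal_idempotentD[OF c]
  have "generalised_eigenspace (mul c) 1 = span {c}"
    using generalised_eigenspace_self_adjoint[of "mul c" 1] mul_self_adjoint
      extremal_eigenspace_one[OF c] by (simp add: mul_simps)
  moreover have "eigenvalue (mul c) 1"
    using nz unfolding eigenvalue_def by auto
  ultimately show ?thesis
    using nz by (simp add: simple_eigenvalue_def dim_span)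
qed

end

theorem proposition6p6:
  fixes mul :: "'a::euclidean_space \<Rightarrow> 'a \<Rightarrow> 'a" and c :: 'a
  assumes "euclidean_metrised_algebra mul"
    and "nonzero_algebra mul"
    and "extremal_idempotent mul c"
  shows "spectrum mul c - {1} \<subseteq> {..1/2} \<and> simple_eigenvalue (mul c) 1"
proof
  show "spectrum mul c - {1} \<subseteq> {..1/2}"
    using euclidean_metrised_algebra.extremal_spectrum[OF assms(1,3)] by blast
  show "simple_eigenvalue (mul c) 1"
    by (rule euclidean_metrised_algebra.extremal_simple_eigenvalue[OF assms(1,3)])
qed

end
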